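(* Let $m\ge n\ge1$ and let $\tau_0,\dots,\tau_{m+n}$ be distinct nodes. Let $\Xi(x)=\xi^{(m)}\mathbf L_m(x)$, with $\xi^{(m)}=[\xi_0\ \cdots\ \xi_m]$, be a polynomial given in the Lagrange basis of degree $m$ at the nodes $\tau_0,\dots,\tau_m$, and let $\Psi(x)=\psi^{(n)}\mathbf L_n(x)$, with $\psi^{(n)}=[\psi_0\ \cdots\ \psi_n]$, be a polynomial given in the Lagrange basis of degree $n$ at the nodes $\tau_0,\dots,\tau_n$. Set $$[s_0\ s_1\ \cdots\ s_{n+m}]=\xi^{(m)}\mathbf R_{m,m+n},\qquad [t_0\ t_1\ \cdots\ t_{n+m}]=\psi^{(n)}\mathbf R_{n,m+n}.$$ Then $$\Xi(x)\Psi(x)=[\,s_0t_0\ \ s_1t_1\ \cdots\ s_{n+m}t_{n+m}\,]\,\mathbf L_{m+n}(x),$$ where $\mathbf L_{m+n}$ is the Lagrange basis at the nodes $\tau_0,\dots,\tau_{m+n}$.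
   Context: For distinct nodes $\tau_0,\tau_1,\dots$ and $N\ge0$, let $w_{N,j}=\prod_{s=0,\,s\ne j}^N\frac{1}{\tau_j-\tau_s}$, $L_{j,N}(x)=w_{N,j}\prod_{s=0,\,s\ne j}^N(x-\tau_s)$ for $j=0,\dots,N$, and $\mathbf L_N(x)=[L_{0,N}(x),\dots,L_{N,N}(x)]^T$. For $p<q$ the lifting matrix $\mathbf R_{p,q}$ is the $(p+1)\times(q+1)$ matrix $\mathbf R_{p,q}=[\,\mathbf I_{p+1}\ |\ \mathbf K\,]$, where $\mathbf I_{p+1}$ is the identity and $\mathbf K$ is the $(p+1)\times(q-p)$ matrix defined recursively by $\mathbf K[i,j]=-\frac{w_{j+p,i-1}}{w_{j+p,j+p}}-\frac{1}{w_{j+p,j+p}}\sum_{r=1}^{j-1}w_{j+p,j+p-r}\mathbf K[i,j-r]$ for $1\le i\le p+1$, $1\le j\le q-p$; it satisfies $\mathbf L_p(x)=\mathbf R_{p,q}\mathbf L_q(x)$. *)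

theory Defs
  imports
    "HOL-Computational_Algebra.Polynomial"
    "Jordan_Normal_Form.Matrix"
begin

definition bary_weight :: "(nat \<Rightarrow> 'a::field) \<Rightarrow> nat \<Rightarrow> nat \<Rightarrow> 'a" where
  "bary_weight \<tau> N j = (\<Prod>s\<in>{0..N} - {j}. 1 / (\<tau> j - \<tau> s))"

text \<open>Everything is a formal polynomial over an arbitrary field, so that an identity in the
  indeterminate \<open>x\<close> is an equality of polynomials (not merely of polynomial functions).\<close>

definition lagrange_poly :: "(nat \<Rightarrow> 'a::field) \<Rightarrow> nat \<Rightarrow> nat \<Rightarrow> 'a poly" where
  "lagrange_poly \<tau> N j = Polynomial.smult (bary_weight \<tau> N j) (\<Prod>s\<in>{0..N} - {j}. [:- \<tau> s, 1:])"

definition lagrange_vec :: "(nat \<Rightarrow> 'a::field) \<Rightarrow> nat \<Rightarrow> 'a poly vec" where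
  "lagrange_vec \<tau> N = vec (N + 1) (\<lambda>j. lagrange_poly \<tau> N j)"

text \<open>A row of scalars times a column of polynomials; scalars become constant polynomials.\<close>

definition row_times_polys :: "'a::field vec \<Rightarrow> 'a poly vec \<Rightarrow> 'a poly" where
  "row_times_polys c v = map_vec (\<lambda>a. [:a:]) c \<bullet> v"

definition row_times_mat :: "'a::field vec \<Rightarrow> 'a mat \<Rightarrow> 'a vec" where
  "row_times_mat v A = vec (dim_col A) (\<lambda>k. v \<bullet> col A k)"

text \<open>The indices \<open>i\<close>, \<open>j\<close> of the entry \<open>K[i,j]\<close> start at 1 here, whereas those of nodes, weights
  and of the matrices of the library start at 0. The entry does not depend on the number of
  columns \<open>q - p\<close>; the value at \<open>i = 0\<close> or \<open>j = 0\<close> is never used.\<close>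

fun lift_K :: "(nat \<Rightarrow> 'a::field) \<Rightarrow> nat \<Rightarrow> nat \<Rightarrow> nat \<Rightarrow> 'a" where
  "lift_K \<tau> p i j =
     - (bary_weight \<tau> (j + p) (i - 1) / bary_weight \<tau> (j + p) (j + p))
     - 1 / bary_weight \<tau> (j + p) (j + p) *
       (\<Sum>r\<in>{1..j - 1}. bary_weight \<tau> (j + p) (j + p - r) * lift_K \<tau> p i (j - r))"

declare lift_K.simps [simp del]

text \<open>The block matrix \<open>[I | K]\<close>, meant for \<open>p < q\<close>; column \<open>k > p\<close> (from 0) is column \<open>k - p\<close>
  (from 1) of \<open>K\<close>.\<close>

definition lifting_mat :: "(nat \<Rightarrow> 'a::field) \<Rightarrow> nat \<Rightarrow> nat \<Rightarrow> 'a mat" where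
  "lifting_mat \<tau> p q = mat (p + 1) (q + 1)
     (\<lambda>(i, k). if k \<le> p then (if i = k then 1 else 0) else lift_K \<tau> p (i + 1) (k - p))"

end

theory Submission
  imports Defs
begin

text \<open>The entry \<open>(i, k)\<close> of a lifting matrix is the value of the \<open>i\<close>-th short Lagrange polynomial at
  the node \<open>\<tau> k\<close>: the recursion for \<open>K\<close> says exactly that the divided difference
  over \<open>\<tau> 0, \<dots>, \<tau> N\<close> of a polynomial of degree less than \<open>N\<close> vanishes. Hence \<open>s k\<close> and \<open>t k\<close>
  are the values of the two factors at \<open>\<tau> k\<close>, and the product, of degree at most \<open>m + n\<close>,
  is recovered by interpolation.\<close>

lemma bary_weight_nonzero:
  assumes "inj_on \<tau> {0..N}" "j \<le> N"
  shows "bary_weight \<tau> N j \<noteq> 0"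
  using assms by (auto simp: bary_weight_def prod_zero_iff dest: inj_onD)

lemma poly_lagrange_poly_node:
  assumes "inj_on \<tau> {0..N}" "j \<le> N" "k \<le> N"
  shows "poly (lagrange_poly \<tau> N j) (\<tau> k) = (if k = j then 1 else 0)"
proof (cases "k = j")
  case True
  have "(\<Prod>s\<in>{0..N} - {j}. 1 / (\<tau> j - \<tau> s)) * (\<Prod>s\<in>{0..N} - {j}. \<tau> j - \<tau> s)
      = (\<Prod>s\<in>{0..N} - {j}. 1)"
    unfolding prod.distrib [symmetric]
    using assms by (intro prod.cong) (auto dest: inj_onD)
  with True show ?thesis
    by (simp add: lagrange_poly_def bary_weight_def poly_prod)
next
  case False
  with assms have "(\<Prod>s\<in>{0..N} - {j}. \<tau> k - \<tau> s) = 0"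
    by (intro prod_zero) auto
  with False show ?thesis
    by (simp add: lagrange_poly_def poly_prod)
qed

lemma degree_lagrange_poly_le: "j \<le> N \<Longrightarrow> degree (lagrange_poly \<tau> N j) \<le> N"
  unfolding lagrange_poly_def
  by (rule order.trans [OF degree_smult_le])
     (simp add: degree_prod_eq_sum_degree)

text \<open>The product of the N linear factors is monic, so the scalar in front of it is the
  coefficient of degree N.\<close>

lemma coeff_lagrange_poly:
  assumes "j \<le> N"
  shows "Polynomial.coeff (lagrange_poly \<tau> N j) N = bary_weight \<tau> N j"
proof -
  have "degree (\<Prod>s\<in>{0..N} - {j}. [:- \<tau> s, 1:]) = N"
    using assms by (simp add: degree_prod_eq_sum_degree)
  moreover have "lead_coeff (\<Prod>s\<in>{0..N} - {j}. [:- \<tau> s, 1:]) = 1"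
    by (simp add: lead_coeff_prod)
  ultimately show ?thesis
    by (simp add: lagrange_poly_def)
qed

text \<open>Both sides have degree at most N and agree at N + 1 distinct points, so they
  coincide.\<close>

lemma lagrange_interpolation:
  assumes inj: "inj_on \<tau> {0..N}" and "degree f \<le> N"
  shows "f = (\<Sum>l\<le>N. Polynomial.smult (poly f (\<tau> l)) (lagrange_poly \<tau> N l))" (is "_ = ?g")
proof (rule poly_eqI_degree)
  fix x assume "x \<in> \<tau> ` {0..N}"
  then obtain k where "k \<le> N" "x = \<tau> k" by auto
  then show "poly f x = poly ?g x"
    using inj by (simp add: poly_sum poly_lagrange_poly_node if_distrib cong: if_cong)
next
  have card: "card (\<tau> ` {0..N}) = Suc N"
    using inj by (simp add: card_image)
  then show "degree f < card (\<tau> ` {0..N})"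
    using assms by simp
  have "degree ?g \<le> N"
    by (intro degree_sum_le order.trans [OF degree_smult_le] degree_lagrange_poly_le) auto
  with card show "degree ?g < card (\<tau> ` {0..N})" by simp
qed

text \<open>Compare the coefficients of degree N in the interpolation formula. The left-hand side is
  the divided difference of f over all N + 1 nodes; it vanishes as soon as the degree of f is below
  N.\<close>

lemma sum_bary_weight_poly:
  assumes "inj_on \<tau> {0..N}" and "degree f \<le> N"
  shows "(\<Sum>l\<le>N. poly f (\<tau> l) * bary_weight \<tau> N l) = Polynomial.coeff f N"
proof -
  have "Polynomial.coeff f N = Polynomial.coeff
      (\<Sum>l\<le>N. Polynomial.smult (poly f (\<tau> l)) (lagrange_poly \<tau> N l)) N"
    using lagrange_interpolation [OF assms] by simp
  also have "\<dots> = (\<Sum>l\<le>N. poly f (\<tau> l) * bary_weight \<tau> N l)"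
    by (simp add: coeff_sum coeff_lagrange_poly)
  finally show ?thesis by simp
qed

text \<open>Strong induction on j, because an entry depends on all earlier entries of its row. The
  row is \<open>Suc i\<close> because K is indexed from 1 and the basis from 0.\<close>

lemma lift_K_eq_poly_lagrange_poly:
  assumes "inj_on \<tau> {0..p + j}" "1 \<le> j" "i \<le> p"
  shows "lift_K \<tau> p (Suc i) j = poly (lagrange_poly \<tau> p i) (\<tau> (p + j))"
  using assms
proof (induction j rule: less_induct)
  case (less j)
  define N where "N = j + p"
  define w where "w = bary_weight \<tau> N"
  define f where "f = lagrange_poly \<tau> p i"
  define S where "S = (\<Sum>r\<in>{1..j - 1}. w (N - r) * poly f (\<tau> (N - r)))"
  have inj: "inj_on \<tau> {0..N}" and injp: "inj_on \<tau> {0..p}"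
    using less.prems(1) by (auto simp: N_def add.commute intro: inj_on_subset)
  have deg: "degree f < N"
    using degree_lagrange_poly_le [OF less.prems(3), of \<tau>] less.prems(2) by (simp add: f_def N_def)
  have IH: "lift_K \<tau> p (Suc i) (j - r) = poly f (\<tau> (N - r))" if "r \<in> {1..j - 1}" for r
  proof -
    have "inj_on \<tau> {0..p + (j - r)}"
      using inj by (rule inj_on_subset) (auto simp: N_def)
    moreover have "p + (j - r) = N - r"
      using that by (auto simp: N_def)
    ultimately show ?thesis
      using less.IH [of "j - r"] less.prems that by (auto simp: f_def)
  qed
  have "(\<Sum>l\<le>N. poly f (\<tau> l) * w l) = 0"
    using sum_bary_weight_poly [OF inj, of f] deg by (simp add: w_def coeff_eq_0)
  \<comment> \<open>Three groups of nodes: up to p, where f is 1 at \<open>\<tau> i\<close> and 0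
    elsewhere, so that only \<open>w i\<close> survives; strictly between p and N, where the
    induction hypothesis applies; and N itself, whose value is solved for.\<close>
  moreover have "{..N} = insert N ({..p} \<union> {p<..<N})"
    using less.prems by (auto simp: N_def)
  ultimately have "0 = poly f (\<tau> N) * w N +
      (\<Sum>l\<in>{..p} \<union> {p<..<N}. poly f (\<tau> l) * w l)"
    using less.prems by (simp add: N_def)
  also have "(\<Sum>l\<in>{..p} \<union> {p<..<N}. poly f (\<tau> l) * w l) =
      (\<Sum>l\<le>p. poly f (\<tau> l) * w l) + (\<Sum>l\<in>{p<..<N}. poly f (\<tau> l) * w l)"
    by (rule sum.union_disjoint) auto
  also have "(\<Sum>l\<le>p. poly f (\<tau> l) * w l) = w i"
    using less.prems injp
    by (simp add: f_def poly_lagrange_poly_node if_distrib [of "\<lambda>x. x * _"] cong: if_cong)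
  \<comment> \<open>Count backwards from N as the recursion does: as N = j + p, the range p < l < N
    becomes 1 \<le> r \<le> j - 1 for r = N - l.\<close>
  also have "(\<Sum>l\<in>{p<..<N}. poly f (\<tau> l) * w l) = (\<Sum>r\<in>{1..j - 1}. w (N - r) * poly f (\<tau> (N - r)))"
    by (rule sum.reindex_bij_witness [of _ "\<lambda>r. N - r" "\<lambda>l. N - l"])
       (use less.prems in \<open>auto simp: N_def\<close>)
  finally have "poly f (\<tau> N) * w N = - (w i + S)"
    unfolding eq_neg_iff_add_eq_0 S_def by (rule sym)
  moreover have "w N \<noteq> 0"
    using bary_weight_nonzero [OF inj] by (simp add: w_def)
  ultimately have "poly f (\<tau> N) = - (w i + S) / w N"
    by (simp add: eq_divide_eq)
  also have "\<dots> = - (w i / w N) - 1 / w N * S"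
    by (simp add: add_divide_distrib diff_divide_distrib)
  also have "\<dots> = lift_K \<tau> p (Suc i) j"
    \<comment> \<open>Only the instance at j is unfolded; the general equation would keep rewriting
      its own recursive calls.\<close>
    unfolding lift_K.simps [of \<tau> p "Suc i" j] N_def [symmetric] w_def [symmetric] diff_Suc_1 S_def
    by (intro arg_cong2 [where f = "(-)"] arg_cong2 [where f = "(*)"] sum.cong refl IH [symmetric])
  finally have "lift_K \<tau> p (Suc i) j = poly f (\<tau> N)" ..
  then show ?case
    by (simp add: f_def N_def add.commute)
qed

text \<open>The identity block expresses that the basis is a Kronecker delta at its own nodes; the
  columns beyond p are those of K, with k - p \<ge> 1.\<close>

lemma lifting_mat_eq_poly_lagrange_poly:
  assumes inj: "inj_on \<tau> {0..q}" and "p \<le> q" "i \<le> p" "k \<le> q"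
  shows "lifting_mat \<tau> p q $$ (i, k) = poly (lagrange_poly \<tau> p i) (\<tau> k)"
proof (cases "k \<le> p")
  case True
  moreover have "inj_on \<tau> {0..p}"
    using inj by (rule inj_on_subset) (use assms in auto)
  ultimately show ?thesis
    using assms by (auto simp: lifting_mat_def poly_lagrange_poly_node)
next
  case False
  moreover have "inj_on \<tau> {0..p + (k - p)}"
    using inj by (rule inj_on_subset) (use assms False in auto)
  ultimately show ?thesis
    using assms lift_K_eq_poly_lagrange_poly [of \<tau> p "k - p" i] by (simp add: lifting_mat_def)
qed

lemma row_times_polys_lagrange_vec:
  assumes "c \<in> carrier_vec (N + 1)"
  shows "row_times_polys c (lagrange_vec \<tau> N) =
    (\<Sum>i\<le>N. Polynomial.smult (c $ i) (lagrange_poly \<tau> N i))"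
proof -
  have "{0..<Suc N} = {..N}" by auto
  with assms show ?thesis
    by (simp add: row_times_polys_def lagrange_vec_def scalar_prod_def)
qed

lemma degree_row_times_polys_lagrange_vec:
  assumes "c \<in> carrier_vec (N + 1)"
  shows "degree (row_times_polys c (lagrange_vec \<tau> N)) \<le> N"
  unfolding row_times_polys_lagrange_vec [OF assms]
  by (intro degree_sum_le order.trans [OF degree_smult_le] degree_lagrange_poly_le) auto

text \<open>By linearity in the coefficients, lifting a row amounts to evaluating its polynomial at
  every node up to q.\<close>

lemma row_times_lifting_mat:
  assumes "inj_on \<tau> {0..q}" "p \<le> q" "k \<le> q" and c: "c \<in> carrier_vec (p + 1)"
  shows "row_times_mat c (lifting_mat \<tau> p q) $ k =
    poly (row_times_polys c (lagrange_vec \<tau> p)) (\<tau> k)"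
proof -
  have dim: "dim_row (lifting_mat \<tau> p q) = Suc p" "dim_col (lifting_mat \<tau> p q) = Suc q"
    by (simp_all add: lifting_mat_def)
  have "{0..<Suc p} = {..p}" by auto
  with assms dim show ?thesis
    by (simp add: row_times_mat_def row_times_polys_lagrange_vec [OF c] scalar_prod_def poly_sum
        lifting_mat_eq_poly_lagrange_poly)
qed

theorem theorem5p11:
  fixes m n :: nat
    and \<tau> :: "nat \<Rightarrow> 'a::field"
    and \<xi> \<psi> s t :: "'a vec"
    and \<Xi> \<Psi> :: "'a poly"
  assumes "m \<ge> n" and "n \<ge> 1"
    and distinct_nodes: "inj_on \<tau> {0..m + n}"
    and "\<xi> \<in> carrier_vec (m + 1)" and "\<psi> \<in> carrier_vec (n + 1)"
    and "\<Xi> = row_times_polys \<xi> (lagrange_vec \<tau> m)"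
    and "\<Psi> = row_times_polys \<psi> (lagrange_vec \<tau> n)"
    and "s = row_times_mat \<xi> (lifting_mat \<tau> m (m + n))"
    and "t = row_times_mat \<psi> (lifting_mat \<tau> n (m + n))"
  shows "\<Xi> * \<Psi> =
    row_times_polys (vec (m + n + 1) (\<lambda>k. s $ k * t $ k)) (lagrange_vec \<tau> (m + n))"
proof -
  \<comment> \<open>This bound is why m + n + 1 nodes suffice to recover the product.\<close>
  have "degree (\<Xi> * \<Psi>) \<le> m + n"
    using degree_row_times_polys_lagrange_vec [of \<xi> m \<tau>]
      degree_row_times_polys_lagrange_vec [of \<psi> n \<tau>] assms
    by (intro order.trans [OF degree_mult_le] add_mono) auto
  then have "\<Xi> * \<Psi> =
      (\<Sum>k\<le>m + n. Polynomial.smult (poly (\<Xi> * \<Psi>) (\<tau> k)) (lagrange_poly \<tau> (m + n) k))"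
    by (rule lagrange_interpolation [OF distinct_nodes])
  \<comment> \<open>Evaluation at a node is multiplicative, hence the entrywise product.\<close>
  also have "\<dots> = (\<Sum>k\<le>m + n. Polynomial.smult (s $ k * t $ k) (lagrange_poly \<tau> (m + n) k))"
    using assms by (intro sum.cong refl) (simp add: row_times_lifting_mat)
  also have "\<dots> = row_times_polys (vec (m + n + 1) (\<lambda>k. s $ k * t $ k)) (lagrange_vec \<tau> (m + n))"
    by (subst row_times_polys_lagrange_vec) simp_all
  finally show ?thesis .
qed

end
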